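(* Let $G=G_1\times\cdots\times G_n$ be a product of finite abstract simplicial complexes, with exterior derivative $d$ and Hodge Laplacian $H=(d+d^* )^2=\bigoplus_{k\ge0}H_k$. Then for every $k\ge 0$, $b_k(G)=\dim(\ker H_k)$, where $b_k(G)$ is the dimension of the $k$-th cohomology group $\ker(d_k)/\mathrm{im}(d_{k-1})$ of $G$.
   Context: A finite abstract simplicial complex is a finite set of finite non-empty sets closed under taking non-empty subsets; $\dim(x)=|x|-1$. The cells of a product $G_1\times\cdots\times G_n$ are $x=(x_1,\dots,x_n)$ with $x_i\in G_i$, and $\dim(x)=\sum_i\dim(x_i)$. Fix an arbitrary orientation of each simplex of a simplicial complex, and let $\delta$ be the corresponding boundary operation on simplices. The exterior derivative of a simplicial complex acts on real functions on its simplices (extended linearly to chains) by $df(x)=f(\delta x)$. For a product of two complexes with boundary operations $\delta_1,\delta_2$, the exterior derivative on functions on cells is $$df(x,y)=f(\delta_1x,y)+(-1)^{\dim(x)}f(x,\delta_2y),$$ and for more factors it is defined iteratively. $d_k$ denotes the restriction of $d$ to functions supported on $k$-dimensional cells (mapping to functions on $(k+1)$-dimensional cells), $d^*$ is the transpose of $d$, and $H_k$ is the block of $H=(d+d^* )^2$ acting on functions on $k$-dimensional cells. *)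

theory Defs
  imports
    "HOL-Combinatorics.Permutations"
    "HOL-Algebra.AbelCoset"
    "Jordan_Normal_Form.VS_Connect"
begin

section \<open>Simplicial complexes and products\<close>

definition abstract_simplicial_complex :: "'a set set \<Rightarrow> bool" where
  "abstract_simplicial_complex G \<longleftrightarrow>
     finite G \<and> (\<forall>x\<in>G. finite x \<and> x \<noteq> {}) \<and> (\<forall>x\<in>G. \<forall>y. y \<noteq> {} \<and> y \<subseteq> x \<longrightarrow> y \<in> G)"

definition simplex_dim :: "'a set \<Rightarrow> nat" where
  "simplex_dim x = card x - 1"

definition product_cells :: "'a set set list \<Rightarrow> 'a set list set" where
  "product_cells Gs = listset Gs"

definition cell_dim :: "'a set list \<Rightarrow> nat" where
  "cell_dim x = sum_list (map simplex_dim x)"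


section \<open>Orientations and boundary\<close>

text \<open>
  An orientation of a simplex is an ordering of its vertices up to even permutations. It is given
  here by a representing list; two lists with the same vertices are compared by the sign of the
  permutation carrying one to the other.
\<close>

definition orientation :: "'a set set \<Rightarrow> ('a set \<Rightarrow> 'a list) \<Rightarrow> bool" where
  "orientation G \<omega> \<longleftrightarrow> (\<forall>x\<in>G. distinct (\<omega> x) \<and> set (\<omega> x) = x)"

definition relative_sign :: "'a list \<Rightarrow> 'a list \<Rightarrow> int" where
  "relative_sign xs ys = sign (THE p. p permutes set xs \<and> map p xs = ys)"

definition delete_nth :: "nat \<Rightarrow> 'a list \<Rightarrow> 'a list" where
  "delete_nth i xs = take i xs @ drop (Suc i) xs"

text \<open>
  If \<^term>\<open>\<omega> x\<close> is the list \<open>v\<^sub>0, \<dots>, v\<^sub>m\<close>, then the boundary of \<open>x\<close> is the chain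
  \<open>\<Sum>i\<le>m. (-1)^i [v\<^sub>0, \<dots>, v\<^sub>i omitted, \<dots>, v\<^sub>m]\<close>; \<open>boundary \<omega> x y\<close> is its coefficient at the oriented
  simplex \<open>y\<close>. The value at \<open>y = {}\<close> is never used, since the empty set is not a simplex: vertices
  have boundary zero.
\<close>

definition boundary :: "('a set \<Rightarrow> 'a list) \<Rightarrow> 'a set \<Rightarrow> 'a set \<Rightarrow> real" where
  "boundary \<omega> x y =
     (\<Sum>i<length (\<omega> x). if set (delete_nth i (\<omega> x)) = y
        then (-1) ^ i * of_int (relative_sign (delete_nth i (\<omega> x)) (\<omega> y)) else 0)"


section \<open>Exterior derivative and Hodge Laplacian\<close>

text \<open>
  The first summand is \<open>f (\<delta>\<^sub>1 x, xs)\<close>, with \<open>f\<close> extended linearly to chains; the second is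
  \<open>(-1)^dim x * f (x, \<delta>\<^sub>2 xs)\<close>, where \<open>\<delta>\<^sub>2\<close> belongs to the product of the remaining factors. The
  empty product is a point, whose derivative is zero, so that for a single factor \<open>d f x = f (\<delta> x)\<close>.
\<close>

fun ext_deriv ::
  "'a set set list \<Rightarrow> ('a set \<Rightarrow> 'a list) list \<Rightarrow> ('a set list \<Rightarrow> real) \<Rightarrow> 'a set list \<Rightarrow> real" where
  "ext_deriv (G # Gs) (\<omega> # \<omega>s) f (x # xs) =
     (\<Sum>y\<in>G. boundary \<omega> x y * f (y # xs))
     + (-1) ^ simplex_dim x * ext_deriv Gs \<omega>s (\<lambda>ys. f (x # ys)) xs"
| "ext_deriv _ _ _ _ = 0"

abbreviation real_field :: "real ring" where
  "real_field \<equiv> class_ring"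

definition cochains :: "'a set set list \<Rightarrow> (real, 'a set list \<Rightarrow> real) module" where
  "cochains Gs = ring.func_space real_field (product_cells Gs)"

definition k_cochains :: "'a set set list \<Rightarrow> nat \<Rightarrow> (real, 'a set list \<Rightarrow> real) module" where
  "k_cochains Gs k = (cochains Gs)
     \<lparr>carrier := {f \<in> carrier (cochains Gs). \<forall>x\<in>product_cells Gs. f x \<noteq> 0 \<longrightarrow> cell_dim x = k}\<rparr>"

definition deriv_op ::
  "'a set set list \<Rightarrow> ('a set \<Rightarrow> 'a list) list \<Rightarrow> ('a set list \<Rightarrow> real) \<Rightarrow> 'a set list \<Rightarrow> real" where
  "deriv_op Gs \<omega>s f = (\<lambda>x\<in>product_cells Gs. ext_deriv Gs \<omega>s f x)"

text \<open>
  Transpose of a linear operator \<open>T\<close> on functions on the finite set \<open>C\<close>, with respect to the standard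
  basis: the matrix entry of \<open>T\<close> in row \<open>y\<close> and column \<open>x\<close> is the value at \<open>y\<close> of \<open>T\<close> applied to the
  indicator function of \<open>x\<close>.
\<close>

definition transpose_op :: "'c set \<Rightarrow> (('c \<Rightarrow> real) \<Rightarrow> 'c \<Rightarrow> real) \<Rightarrow> ('c \<Rightarrow> real) \<Rightarrow> 'c \<Rightarrow> real" where
  "transpose_op C T f = (\<lambda>x\<in>C. \<Sum>y\<in>C. T (\<lambda>z\<in>C. if z = x then 1 else 0) y * f y)"

definition dirac_op ::
  "'a set set list \<Rightarrow> ('a set \<Rightarrow> 'a list) list \<Rightarrow> ('a set list \<Rightarrow> real) \<Rightarrow> 'a set list \<Rightarrow> real" where
  "dirac_op Gs \<omega>s f =
     deriv_op Gs \<omega>s f \<oplus>\<^bsub>cochains Gs\<^esub> transpose_op (product_cells Gs) (deriv_op Gs \<omega>s) f"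

definition hodge_laplacian ::
  "'a set set list \<Rightarrow> ('a set \<Rightarrow> 'a list) list \<Rightarrow> ('a set list \<Rightarrow> real) \<Rightarrow> 'a set list \<Rightarrow> real" where
  "hodge_laplacian Gs \<omega>s f = dirac_op Gs \<omega>s (dirac_op Gs \<omega>s f)"

definition hodge_block ::
  "'a set set list \<Rightarrow> ('a set \<Rightarrow> 'a list) list \<Rightarrow> nat \<Rightarrow> ('a set list \<Rightarrow> real) \<Rightarrow> 'a set list \<Rightarrow> real" where
  "hodge_block Gs \<omega>s k f =
     (\<lambda>x\<in>product_cells Gs. if cell_dim x = k then hodge_laplacian Gs \<omega>s f x else 0)"

definition hodge_kernel ::
  "'a set set list \<Rightarrow> ('a set \<Rightarrow> 'a list) list \<Rightarrow> nat \<Rightarrow> (real, 'a set list \<Rightarrow> real) module" where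
  "hodge_kernel Gs \<omega>s k = (k_cochains Gs k)
     \<lparr>carrier := mod_hom.ker (k_cochains Gs k) (k_cochains Gs k) (hodge_block Gs \<omega>s k)\<rparr>"


section \<open>Cohomology\<close>

text \<open>
  The quotient of a vector space by a subspace \<open>W\<close>, on the set of cosets. The fields \<open>mult\<close> and
  \<open>one\<close>, present in every module record, carry no meaning. The scalar multiple of the coset
  \<open>W + v\<close> by \<open>c\<close> is \<open>W + c v\<close>, also for \<open>c = 0\<close>.
\<close>

definition quotient_space :: "('r, 'v, 'e) module_scheme \<Rightarrow> 'v set \<Rightarrow> ('r, 'v set) module" where
  "quotient_space V W =
     \<lparr>carrier = a_rcosets\<^bsub>V\<^esub> W, mult = (\<lambda>X Y. W), one = W, zero = W,
      add = (\<lambda>X Y. X <+>\<^bsub>V\<^esub> Y), smult = (\<lambda>c X. \<Union>v\<in>X. W +>\<^bsub>V\<^esub> (c \<odot>\<^bsub>V\<^esub> v))\<rparr>"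

definition cocycles ::
  "'a set set list \<Rightarrow> ('a set \<Rightarrow> 'a list) list \<Rightarrow> nat \<Rightarrow> (real, 'a set list \<Rightarrow> real) module" where
  "cocycles Gs \<omega>s k = (k_cochains Gs k)
     \<lparr>carrier := mod_hom.ker (k_cochains Gs k) (k_cochains Gs (Suc k)) (deriv_op Gs \<omega>s)\<rparr>"

definition coboundaries ::
  "'a set set list \<Rightarrow> ('a set \<Rightarrow> 'a list) list \<Rightarrow> nat \<Rightarrow> ('a set list \<Rightarrow> real) set" where
  "coboundaries Gs \<omega>s k =
     (case k of 0 \<Rightarrow> {\<zero>\<^bsub>cochains Gs\<^esub>}
      | Suc j \<Rightarrow> mod_hom.im (k_cochains Gs j) (deriv_op Gs \<omega>s))"

definition cohomology ::
  "'a set set list \<Rightarrow> ('a set \<Rightarrow> 'a list) list \<Rightarrow> nat \<Rightarrow> (real, ('a set list \<Rightarrow> real) set) module" where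
  "cohomology Gs \<omega>s k = quotient_space (cocycles Gs \<omega>s k) (coboundaries Gs \<omega>s k)"

definition betti :: "'a set set list \<Rightarrow> ('a set \<Rightarrow> 'a list) list \<Rightarrow> nat \<Rightarrow> nat" where
  "betti Gs \<omega>s k = vectorspace.dim real_field (cohomology Gs \<omega>s k)"

end

theory Submission
  imports Defs
begin

text \<open>
  The theorem is the finite-dimensional Hodge theorem. Functions on the cells carry the inner product
  in which the indicator functions of cells are orthonormal, and the transpose \<open>d*\<close> of the exterior
  derivative \<open>d\<close> is its adjoint. Once \<open>d\<close> is known to raise the dimension of cells by one and to square
  to zero, linear algebra does the rest.

  The kernel of the block \<open>H_k\<close> consists of the \<open>f\<close> of degree \<open>k\<close> with \<open>d f = 0\<close> and \<open>d* f = 0\<close>: if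
  \<open>H_k f = 0\<close>, then \<open>\<langle>f, H f\<rangle>\<close>, the squared norm of \<open>(d + d*) f\<close>, vanishes, and \<open>d f\<close> and \<open>d* f\<close> are
  orthogonal to each other (\<open>harmonic_iff_laplacian\<close>). These harmonic functions form a complement of
  the coboundaries inside the cocycles: the orthogonal projection of a cocycle to the coboundaries
  leaves a harmonic remainder (\<open>hodge_decomposition\<close>), and a harmonic coboundary is orthogonal to
  itself (\<open>coboundary_Int_harmonic\<close>). A complement of a subspace is isomorphic to the quotient by it
  (\<open>dim_quotient_space\<close>), which gives the equality of dimensions.

  That \<open>d\<close> squares to zero is where orientations enter. The coefficient of a face \<open>y = x - {u}\<close> in the
  boundary of \<open>x\<close> is the sign of the chosen ordering of \<open>x\<close> relative to \<open>u\<close> followed by the chosen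
  ordering of \<open>y\<close> (\<open>boundary_face\<close>). In this form coefficients multiply by composing permutations, and
  the two ways of deleting a pair of vertices differ by one transposition (\<open>boundary_boundary\<close>). For
  products, the sign \<open>(-1)^dim\<close> makes the mixed second derivatives cancel (\<open>ext_deriv_ext_deriv\<close>).
\<close>

section \<open>Relative signs of orderings\<close>

text \<open>
  A permutation that fixes everything outside the list is determined by the image of the list, so
  the definite description in the definition is met by whichever permutation one exhibits.
\<close>

lemma relative_sign_eq:
  assumes "p permutes set xs" "map p xs = ys"
  shows "relative_sign xs ys = sign p"
proof -
  have "(THE q. q permutes set xs \<and> map q xs = ys) = p"
  proof (rule the_equality)
    fix q assume q: "q permutes set xs \<and> map q xs = ys"
    show "q = p"
    proof
      fix a show "q a = p a"
        using q assms by (cases "a \<in> set xs") (auto simp: permutes_not_in)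
    qed
  qed (use assms in auto)
  then show ?thesis unfolding relative_sign_def by simp
qed

lemma ex_permutation_between:
  assumes "distinct xs" "distinct ys" "set ys = set xs"
  obtains p where "p permutes set xs" "map p xs = ys"
proof -
  define p where "p a = (if a \<in> set xs then the (map_of (zip xs ys) a) else a)" for a
  have len: "length xs = length ys" using assms by (metis distinct_card)
  have map: "map p xs = ys"
    using len assms(1) by (intro nth_equalityI) (auto simp: p_def map_of_zip_nth)
  then have im: "p ` set xs = set xs" using assms(3) by (metis set_map)
  then have "bij_betw p (set xs) (set xs)"
    by (auto simp: bij_betw_def intro: eq_card_imp_inj_on)
  then have "p permutes set xs" by (rule bij_imp_permutes) (simp add: p_def)
  with map that show thesis by blast
qed

lemma relative_sign_trans:
  assumes "distinct xs" "distinct ys" "distinct zs" "set ys = set xs" "set zs = set xs"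
  shows "relative_sign xs ys * relative_sign ys zs = relative_sign xs zs"
proof -
  obtain p where p: "p permutes set xs" "map p xs = ys"
    using assms ex_permutation_between by metis
  obtain q where q: "q permutes set ys" "map q ys = zs"
    using assms ex_permutation_between by metis
  have "relative_sign xs zs = sign (q \<circ> p)"
    using p q assms(4) by (intro relative_sign_eq) (auto intro: permutes_compose)
  also have "\<dots> = sign q * sign p"
    using p q by (intro sign_compose) (auto simp: permutation_permutes)
  finally show ?thesis
    using p q by (simp add: relative_sign_eq)
qed

lemma relative_sign_refl: "relative_sign xs xs = 1"
  by (subst relative_sign_eq[where p = id]) (auto simp: permutes_id)

lemma relative_sign_Cons:
  assumes "distinct (u # xs)" "distinct ys" "set ys = set xs"
  shows "relative_sign (u # xs) (u # ys) = relative_sign xs ys"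
proof -
  obtain p where p: "p permutes set xs" "map p xs = ys"
    using assms ex_permutation_between by (metis distinct.simps(2))
  have "p u = u" using p assms(1) by (auto simp: permutes_not_in)
  then show ?thesis
    using p by (simp add: relative_sign_eq[of p] permutes_subset[of p "set xs"] subset_insertI)
qed

lemma relative_sign_swap:
  assumes "distinct (u # v # xs)"
  shows "relative_sign (u # v # xs) (v # u # xs) = -1"
proof -
  have "map (transpose u v) xs = xs"
    using assms by (intro map_idI) (auto simp: transpose_def)
  moreover have "transpose u v permutes set (u # v # xs)"
    by (rule permutes_swap_id) auto
  ultimately have "relative_sign (u # v # xs) (v # u # xs) = sign (transpose u v)"
    by (intro relative_sign_eq) auto
  with assms show ?thesis by (simp add: sign_swap_id)
qed

lemma set_delete_nth:
  assumes "distinct xs" "i < length xs"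
  shows "set (delete_nth i xs) = set xs - {xs ! i}" "distinct (delete_nth i xs)"
    "xs ! i \<notin> set (delete_nth i xs)"
proof -
  have eq: "xs = take i xs @ xs ! i # drop (Suc i) xs"
    using assms(2) by (simp add: id_take_nth_drop)
  then have "distinct (take i xs @ xs ! i # drop (Suc i) xs)" using assms(1) by simp
  moreover have "set xs = set (take i xs @ xs ! i # drop (Suc i) xs)"
    using eq by simp
  ultimately show "set (delete_nth i xs) = set xs - {xs ! i}" "distinct (delete_nth i xs)"
    "xs ! i \<notin> set (delete_nth i xs)"
    by (auto simp: delete_nth_def)
qed

text \<open>
  Bringing the vertex at position \<open>i\<close> to the front passes it over \<open>i\<close> others, one transposition
  for each. This explains the sign \<open>(-1)^i\<close> in the boundary as an instance of a relative sign.
\<close>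

lemma relative_sign_move_to_front:
  assumes "distinct xs" "i < length xs"
  shows "relative_sign xs (xs ! i # delete_nth i xs) = (-1) ^ i"
  using assms
proof (induction xs arbitrary: i)
  case (Cons a xs)
  show ?case
  proof (cases i)
    case 0
    then show ?thesis by (simp add: delete_nth_def relative_sign_refl)
  next
    case (Suc j)
    let ?v = "xs ! j" and ?ds = "delete_nth j xs"
    have j: "j < length xs" and xs: "distinct xs" "a \<notin> set xs" using Cons.prems Suc by auto
    note ds = set_delete_nth[OF xs(1) j]
    have v: "?v \<in> set xs" using j by simp
    have "relative_sign (a # xs) (?v # a # ?ds)
        = relative_sign (a # xs) (a # ?v # ?ds) * relative_sign (a # ?v # ?ds) (?v # a # ?ds)"
      using ds xs v by (intro relative_sign_trans[symmetric]) auto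
    also have "relative_sign (a # xs) (a # ?v # ?ds) = relative_sign xs (?v # ?ds)"
      using ds xs v by (intro relative_sign_Cons) auto
    also have "\<dots> = (-1) ^ j" by (rule Cons.IH[OF xs(1) j])
    also have "relative_sign (a # ?v # ?ds) (?v # a # ?ds) = -1"
      using ds xs v by (intro relative_sign_swap) auto
    finally show ?thesis using Suc by (simp add: delete_nth_def)
  qed
qed simp

section \<open>The simplicial boundary squares to zero\<close>

text \<open>
  With the position of the omitted vertex absorbed into a relative sign, the coefficient compares
  two orderings of the same simplex \<open>x\<close>. Products of such coefficients then telescope.
\<close>

lemma boundary_face:
  assumes "distinct (\<omega> x)" "u \<in> set (\<omega> x)"
    and "distinct (\<omega> y)" "set (\<omega> y) = y" "y = set (\<omega> x) - {u}"
  shows "boundary \<omega> x y = of_int (relative_sign (\<omega> x) (u # \<omega> y))"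
proof -
  obtain i where i: "i < length (\<omega> x)" "\<omega> x ! i = u"
    using assms(2) by (auto simp: in_set_conv_nth)
  let ?ds = "delete_nth i (\<omega> x)"
  note ds = set_delete_nth[OF assms(1) i(1)]
  have other: "set (delete_nth j (\<omega> x)) = y \<longleftrightarrow> j = i" if j: "j < length (\<omega> x)" for j
  proof -
    have "set (delete_nth j (\<omega> x)) = y \<longleftrightarrow> \<omega> x ! j = u"
      unfolding set_delete_nth(1)[OF assms(1) j] assms(5) using nth_mem[OF j] assms(2) by blast
    also have "\<dots> \<longleftrightarrow> j = i"
      using nth_eq_iff_index_eq[OF assms(1) j i(1)] i(2) by simp
    finally show ?thesis .
  qed
  have "boundary \<omega> x y = (\<Sum>j<length (\<omega> x). if j = i
      then (-1) ^ j * of_int (relative_sign (delete_nth j (\<omega> x)) (\<omega> y)) else 0)"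
    unfolding boundary_def by (intro sum.cong) (auto simp: other)
  also have "\<dots> = (-1) ^ i * of_int (relative_sign ?ds (\<omega> y))"
    using i by simp
  also have "\<dots> = of_int (relative_sign (\<omega> x) (u # ?ds) * relative_sign ?ds (\<omega> y))"
    using relative_sign_move_to_front[OF assms(1) i(1)] i by simp
  also have "relative_sign ?ds (\<omega> y) = relative_sign (u # ?ds) (u # \<omega> y)"
    using ds i assms by (intro relative_sign_Cons[symmetric]) auto
  also have "relative_sign (\<omega> x) (u # ?ds) * relative_sign (u # ?ds) (u # \<omega> y)
      = relative_sign (\<omega> x) (u # \<omega> y)"
    using ds i assms by (intro relative_sign_trans) auto
  finally show ?thesis .
qed

lemma boundary_nonzero:
  assumes "distinct (\<omega> x)" "boundary \<omega> x y \<noteq> 0"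
  obtains u where "u \<in> set (\<omega> x)" "y = set (\<omega> x) - {u}"
proof -
  obtain i where i: "i < length (\<omega> x)" "set (delete_nth i (\<omega> x)) = y"
  proof (rule ccontr)
    assume "\<not> thesis"
    with that have "set (delete_nth i (\<omega> x)) \<noteq> y" if "i < length (\<omega> x)" for i
      using \<open>i < length (\<omega> x)\<close> by blast
    then have "boundary \<omega> x y = 0" unfolding boundary_def by (intro sum.neutral) simp
    with assms(2) show False ..
  qed
  show thesis
    using that[of "\<omega> x ! i"] i nth_mem[OF i(1)] set_delete_nth(1)[OF assms(1) i(1)] by metis
qed

lemma boundary_nonzero_face:
  assumes "orientation G \<omega>" "x \<in> G" "boundary \<omega> x y \<noteq> 0"
  obtains u where "u \<in> x" "y = x - {u}"
proof -
  have "distinct (\<omega> x)" "set (\<omega> x) = x" using assms(1,2) by (auto simp: orientation_def)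
  then show thesis using boundary_nonzero[of \<omega> x y] assms(3) that by metis
qed

lemma boundary_dim:
  assumes "abstract_simplicial_complex G" "orientation G \<omega>" "x \<in> G" "y \<in> G" "boundary \<omega> x y \<noteq> 0"
  shows "simplex_dim x = Suc (simplex_dim y)"
proof -
  obtain u where u: "u \<in> x" "y = x - {u}" using boundary_nonzero_face[OF assms(2,3,5)] .
  have fin: "finite x" "finite y" "y \<noteq> {}"
    using assms(1,3,4) unfolding abstract_simplicial_complex_def by blast+
  have "card y > 0" using fin by (simp add: card_gt_0_iff)
  moreover have "card x = Suc (card y)" using u fin card.remove[of x u] by simp
  ultimately show ?thesis by (simp add: simplex_dim_def)
qed

text \<open>
  A face \<open>z\<close> of codimension two, \<open>z = x - {u, v}\<close>, is reached from \<open>x\<close> by exactly two paths, which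
  delete \<open>u\<close> and \<open>v\<close> in either order. By telescoping, the two paths contribute the signs of \<open>\<omega> x\<close>
  relative to \<open>u # v # \<omega> z\<close> and to \<open>v # u # \<omega> z\<close>, which are opposite. Other
  simplices \<open>z\<close> are not reached at all.
\<close>

lemma boundary_boundary:
  assumes G: "abstract_simplicial_complex G" and or: "orientation G \<omega>" and x: "x \<in> G" and z: "z \<in> G"
  shows "(\<Sum>y\<in>G. boundary \<omega> x y * boundary \<omega> y z) = 0"
proof (cases "\<exists>y\<in>G. boundary \<omega> x y * boundary \<omega> y z \<noteq> 0")
  case True
  then obtain y where y: "y \<in> G" "boundary \<omega> x y \<noteq> 0" "boundary \<omega> y z \<noteq> 0" by auto
  obtain u where u: "u \<in> x" "y = x - {u}" using boundary_nonzero_face[OF or x y(2)] .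
  obtain v where v: "v \<in> y" "z = y - {v}" using boundary_nonzero_face[OF or y(1,3)] .
  let ?y = "x - {u}" and ?y' = "x - {v}"
  have uv: "u \<noteq> v" "v \<in> x" "z = x - {u, v}" using u v by auto
  have mem: "?y \<in> G" "?y' \<in> G"
  proof -
    have face: "w \<in> G" if "w \<noteq> {}" "w \<subseteq> x" for w
      using G x that unfolding abstract_simplicial_complex_def by blast
    show "?y \<in> G" by (rule face) (use uv in auto)
    show "?y' \<in> G" by (rule face) (use u uv in auto)
  qed
  have o: "distinct (\<omega> w)" "set (\<omega> w) = w" if "w \<in> G" for w
    using or that by (auto simp: orientation_def)
  have sub: "y' \<in> {?y, ?y'}" if y': "y' \<in> G" "boundary \<omega> x y' * boundary \<omega> y' z \<noteq> 0" for y'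
  proof -
    have nz: "boundary \<omega> x y' \<noteq> 0" "boundary \<omega> y' z \<noteq> 0" using y'(2) by auto
    obtain u' where u': "u' \<in> x" "y' = x - {u'}" using boundary_nonzero_face[OF or x nz(1)] .
    obtain v' where v': "v' \<in> y'" "z = y' - {v'}" using boundary_nonzero_face[OF or y'(1) nz(2)] .
    have "u' \<notin> z" using u' v' by auto
    then show ?thesis using u' uv by auto
  qed
  have path: "boundary \<omega> x (x - {a}) * boundary \<omega> (x - {a}) z
      = of_int (relative_sign (\<omega> x) (a # b # \<omega> z))"
    if ab: "a \<in> x" "b \<in> x" "a \<noteq> b" "z = x - {a, b}" "x - {a} \<in> G" for a b
  proof -
    let ?w = "x - {a}"
    have 1: "boundary \<omega> x ?w = of_int (relative_sign (\<omega> x) (a # \<omega> ?w))"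
      using o[OF x] o[OF ab(5)] ab by (intro boundary_face) auto
    have 2: "boundary \<omega> ?w z = of_int (relative_sign (\<omega> ?w) (b # \<omega> z))"
      using o[OF ab(5)] o[OF z] ab by (intro boundary_face) auto
    have 3: "relative_sign (\<omega> ?w) (b # \<omega> z) = relative_sign (a # \<omega> ?w) (a # b # \<omega> z)"
      using o[OF ab(5)] o[OF z] ab by (intro relative_sign_Cons[symmetric]) auto
    have "relative_sign (\<omega> x) (a # \<omega> ?w) * relative_sign (a # \<omega> ?w) (a # b # \<omega> z)
        = relative_sign (\<omega> x) (a # b # \<omega> z)"
      using o[OF x] o[OF ab(5)] o[OF z] ab by (intro relative_sign_trans) auto
    then show ?thesis unfolding 1 2 3 by (metis of_int_mult)
  qed
  have "relative_sign (\<omega> x) (u # v # \<omega> z) * relative_sign (u # v # \<omega> z) (v # u # \<omega> z)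
      = relative_sign (\<omega> x) (v # u # \<omega> z)"
    using o[OF x] o[OF z] uv u by (intro relative_sign_trans) auto
  moreover have "relative_sign (u # v # \<omega> z) (v # u # \<omega> z) = -1"
    using o[OF z] uv u by (intro relative_sign_swap) auto
  ultimately have swap: "relative_sign (\<omega> x) (v # u # \<omega> z) = - relative_sign (\<omega> x) (u # v # \<omega> z)"
    by simp
  have "finite G" using G by (simp add: abstract_simplicial_complex_def)
  then have "(\<Sum>y\<in>G. boundary \<omega> x y * boundary \<omega> y z)
      = (\<Sum>y\<in>{?y, ?y'}. boundary \<omega> x y * boundary \<omega> y z)"
    using mem sub by (intro sum.mono_neutral_right) auto
  also have "\<dots> = boundary \<omega> x ?y * boundary \<omega> ?y z + boundary \<omega> x ?y' * boundary \<omega> ?y' z"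
    using uv u by (subst sum.insert) auto
  also have "\<dots> = 0"
    using path[of u v] path[of v u] mem uv u swap by (simp add: insert_commute)
  finally show ?thesis .
qed (auto intro: sum.neutral)

section \<open>The exterior derivative of a product squares to zero\<close>

abbreviation oriented_complexes ::
  "'a set set list \<Rightarrow> ('a set \<Rightarrow> 'a list) list \<Rightarrow> bool" where
  "oriented_complexes \<equiv> list_all2 (\<lambda>G \<omega>. abstract_simplicial_complex G \<and> orientation G \<omega>)"

lemma Cons_in_product_cells:
  "x \<in> product_cells (G # Gs) \<longleftrightarrow> (\<exists>y ys. x = y # ys \<and> y \<in> G \<and> ys \<in> product_cells Gs)"
  by (auto simp: product_cells_def set_Cons_def)

lemma finite_product_cells:
  assumes "\<And>G. G \<in> set Gs \<Longrightarrow> finite G"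
  shows "finite (product_cells Gs)"
  using assms
proof (induction Gs)
  case (Cons G Gs)
  have "product_cells (G # Gs) = (\<lambda>(y, ys). y # ys) ` (G \<times> product_cells Gs)"
    by (auto simp: Cons_in_product_cells)
  then show ?case using Cons by simp
qed (simp add: product_cells_def)

lemma ext_deriv_linear:
  "ext_deriv Gs \<omega>s (\<lambda>x. \<Sum>i\<in>I. c i * f i x) x = (\<Sum>i\<in>I. c i * ext_deriv Gs \<omega>s (f i) x)"
proof (induction Gs \<omega>s "\<lambda>x. \<Sum>i\<in>I. c i * f i x" x arbitrary: f rule: ext_deriv.induct)
  case (1 G Gs \<omega> \<omega>s x xs)
  have "ext_deriv (G # Gs) (\<omega> # \<omega>s) (\<lambda>x. \<Sum>i\<in>I. c i * f i x) (x # xs)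
     = (\<Sum>y\<in>G. \<Sum>i\<in>I. c i * (boundary \<omega> x y * f i (y # xs)))
       + (\<Sum>i\<in>I. c i * ((-1) ^ simplex_dim x * ext_deriv Gs \<omega>s (\<lambda>ys. f i (x # ys)) xs))"
    using 1[of "\<lambda>i ys. f i (x # ys)"] by (simp add: sum_distrib_left mult.left_commute)
  also have "(\<Sum>y\<in>G. \<Sum>i\<in>I. c i * (boundary \<omega> x y * f i (y # xs)))
     = (\<Sum>i\<in>I. c i * (\<Sum>y\<in>G. boundary \<omega> x y * f i (y # xs)))"
    by (subst sum.swap) (simp add: sum_distrib_left)
  finally show ?case by (simp add: sum.distrib distrib_left)
qed simp_all

lemma ext_deriv_cong:
  assumes "\<And>y. y \<in> product_cells Gs \<Longrightarrow> f y = g y" "x \<in> product_cells Gs"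
  shows "ext_deriv Gs \<omega>s f x = ext_deriv Gs \<omega>s g x"
  using assms
proof (induction Gs \<omega>s f x arbitrary: g rule: ext_deriv.induct)
  case (1 G Gs \<omega> \<omega>s f x xs)
  have "ext_deriv Gs \<omega>s (\<lambda>ys. f (x # ys)) xs = ext_deriv Gs \<omega>s (\<lambda>ys. g (x # ys)) xs"
    using "1.prems" by (intro "1.IH") (auto simp: Cons_in_product_cells)
  moreover have "(\<Sum>y\<in>G. boundary \<omega> x y * f (y # xs)) = (\<Sum>y\<in>G. boundary \<omega> x y * g (y # xs))"
    using "1.prems" by (intro sum.cong) (auto simp: Cons_in_product_cells)
  ultimately show ?case by simp
qed simp_all

text \<open>
  The value at \<open>x\<close> depends only on cells of dimension one less: this is what makes the derivative
  homogeneous of degree one.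
\<close>

lemma ext_deriv_degree:
  assumes "oriented_complexes Gs \<omega>s" "x \<in> product_cells Gs"
    and "\<And>y. y \<in> product_cells Gs \<Longrightarrow> cell_dim x = Suc (cell_dim y) \<Longrightarrow> f y = 0"
  shows "ext_deriv Gs \<omega>s f x = 0"
  using assms
proof (induction arbitrary: f x rule: list_all2_induct)
  case (Cons G Gs \<omega> \<omega>s)
  obtain s xs where x: "x = s # xs" "s \<in> G" "xs \<in> product_cells Gs"
    using Cons.prems(1) by (auto simp: Cons_in_product_cells)
  have "boundary \<omega> s y * f (y # xs) = 0" if "y \<in> G" for y
  proof (cases "boundary \<omega> s y = 0")
    case False
    then have "simplex_dim s = Suc (simplex_dim y)" using boundary_dim Cons.hyps x that by blast
    then have "f (y # xs) = 0"
      using x that by (intro Cons.prems(2)) (auto simp: Cons_in_product_cells cell_dim_def)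
    then show ?thesis by simp
  qed simp
  moreover have "ext_deriv Gs \<omega>s (\<lambda>ys. f (s # ys)) xs = 0"
    using x by (intro Cons.IH Cons.prems(2)) (auto simp: Cons_in_product_cells cell_dim_def)
  ultimately show ?case by (simp add: x)
qed simp

text \<open>
  By induction on the number of factors. The two pure terms vanish, by the previous section for the
  first factor and by the induction hypothesis for the others. The two mixed terms agree up to the
  signs \<open>(-1)^dim y\<close> and \<open>(-1)^dim s\<close>, where \<open>s\<close> is the first component of the cell, and these are
  opposite because only faces \<open>y\<close> of \<open>s\<close> of codimension one occur.
\<close>

lemma ext_deriv_ext_deriv:
  assumes "oriented_complexes Gs \<omega>s" "x \<in> product_cells Gs"
  shows "ext_deriv Gs \<omega>s (ext_deriv Gs \<omega>s f) x = 0"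
  using assms
proof (induction arbitrary: f x rule: list_all2_induct)
  case (Cons G Gs \<omega> \<omega>s)
  obtain s xs where x: "x = s # xs" "s \<in> G" "xs \<in> product_cells Gs"
    using Cons.prems(1) by (auto simp: Cons_in_product_cells)
  have G: "abstract_simplicial_complex G" "orientation G \<omega>"
    using Cons.hyps by blast+
  then have fin: "finite G" by (simp add: abstract_simplicial_complex_def)
  let ?D = "ext_deriv Gs \<omega>s" and ?b = "boundary \<omega>" and ?f = "\<lambda>y ys. f (y # ys)"
  let ?e = "\<lambda>y. (-1::real) ^ simplex_dim y"
  let ?S = "\<Sum>y\<in>G. ?b s y * ?D (?f y) xs"
  have "(\<Sum>y\<in>G. ?b s y * (\<Sum>z\<in>G. ?b y z * f (z # xs)))
      = (\<Sum>y\<in>G. \<Sum>z\<in>G. ?b s y * ?b y z * f (z # xs))"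
    by (simp add: sum_distrib_left mult.assoc)
  also have "\<dots> = (\<Sum>z\<in>G. (\<Sum>y\<in>G. ?b s y * ?b y z) * f (z # xs))"
    by (subst sum.swap) (simp add: sum_distrib_right)
  also have "\<dots> = 0"
    using boundary_boundary[OF G(1,2) x(2)] by (intro sum.neutral) simp
  finally have bb: "(\<Sum>y\<in>G. ?b s y * (\<Sum>z\<in>G. ?b y z * f (z # xs))) = 0" .
  have "?b s y * (?e y * ?D (?f y) xs) = - ?e s * (?b s y * ?D (?f y) xs)" if "y \<in> G" for y
  proof (cases "?b s y = 0")
    case False
    then have "simplex_dim s = Suc (simplex_dim y)" using boundary_dim G x that by blast
    then show ?thesis by simp
  qed simp
  then have mixed: "(\<Sum>y\<in>G. ?b s y * (?e y * ?D (?f y) xs)) = - ?e s * ?S"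
    by (simp add: sum_distrib_left)
  \<comment> \<open>The derivative along the slice \<open>s\<close> is one linear combination: the index \<open>None\<close> stands for the
     derivative in the remaining factors, \<open>Some y\<close> for the boundary component at \<open>y\<close>.\<close>
  have "(\<lambda>ys. ext_deriv (G # Gs) (\<omega> # \<omega>s) f (s # ys))
      = (\<lambda>ys. \<Sum>i\<in>insert None (Some ` G). (case i of None \<Rightarrow> ?e s | Some y \<Rightarrow> ?b s y)
          * (case i of None \<Rightarrow> ?D (?f s) ys | Some y \<Rightarrow> f (y # ys)))"
    using fin by (auto simp: sum.reindex)
  then have "?D (\<lambda>ys. ext_deriv (G # Gs) (\<omega> # \<omega>s) f (s # ys)) xs
      = (\<Sum>i\<in>insert None (Some ` G). (case i of None \<Rightarrow> ?e s | Some y \<Rightarrow> ?b s y)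
          * ?D (\<lambda>ys. case i of None \<Rightarrow> ?D (?f s) ys | Some y \<Rightarrow> f (y # ys)) xs)"
    by (simp only: ext_deriv_linear)
  also have "\<dots> = ?e s * ?D (?D (?f s)) xs + ?S"
    using fin by (simp add: sum.reindex)
  also have "?D (?D (?f s)) xs = 0" by (rule Cons.IH[OF x(3)])
  finally have tail: "?D (\<lambda>ys. ext_deriv (G # Gs) (\<omega> # \<omega>s) f (s # ys)) xs = ?S" by simp
  have "ext_deriv (G # Gs) (\<omega> # \<omega>s) (ext_deriv (G # Gs) (\<omega> # \<omega>s) f) x
      = (\<Sum>y\<in>G. ?b s y * ((\<Sum>z\<in>G. ?b y z * f (z # xs)) + ?e y * ?D (?f y) xs)) + ?e s * ?S"
    unfolding x(1) by (subst ext_deriv.simps(1), subst tail) simp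
  also have "\<dots> = 0"
    using bb mixed by (simp add: distrib_left sum.distrib)
  finally show ?case .
qed simp

text \<open>
  The matrix of the exterior derivative in the basis of indicator functions of cells.
\<close>

definition incidence ::
  "'a set set list \<Rightarrow> ('a set \<Rightarrow> 'a list) list \<Rightarrow> 'a set list \<Rightarrow> 'a set list \<Rightarrow> real" where
  "incidence Gs \<omega>s x y = ext_deriv Gs \<omega>s (\<lambda>z. if z = y then 1 else 0) x"

lemma ext_deriv_incidence:
  assumes "finite (product_cells Gs)" "x \<in> product_cells Gs"
  shows "ext_deriv Gs \<omega>s f x = (\<Sum>y\<in>product_cells Gs. incidence Gs \<omega>s x y * f y)"
proof -
  have "ext_deriv Gs \<omega>s f x
      = ext_deriv Gs \<omega>s (\<lambda>z. \<Sum>y\<in>product_cells Gs. f y * (if z = y then 1 else 0)) x"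
    using assms by (intro ext_deriv_cong) (simp_all add: if_distrib cong: if_cong)
  then show ?thesis by (simp add: ext_deriv_linear incidence_def mult.commute)
qed

section \<open>Hodge theory of a finite cochain complex\<close>

text \<open>
  Some linear combination of the functions \<open>v i\<close> leaves a remainder orthogonal to all of them. As in
  the Gram--Schmidt process, a new function is first replaced by its own remainder \<open>a\<close> with respect to
  the earlier ones; subtracting the component of \<open>f\<close> along \<open>a\<close> then keeps the orthogonality already
  achieved.
\<close>

lemma orthogonal_projection:
  fixes f :: "'c \<Rightarrow> real" and v :: "'i \<Rightarrow> 'c \<Rightarrow> real"
  assumes "finite I" "finite C"
  shows "\<exists>c. \<forall>i\<in>I. (\<Sum>x\<in>C. (f x - (\<Sum>j\<in>I. c j * v j x)) * v i x) = 0"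
  using assms(1)
proof (induction I arbitrary: f)
  case (insert i I)
  obtain c where c: "\<And>j. j \<in> I \<Longrightarrow> (\<Sum>x\<in>C. (f x - (\<Sum>j\<in>I. c j * v j x)) * v j x) = 0"
    using insert.IH by blast
  obtain e where e: "\<And>j. j \<in> I \<Longrightarrow> (\<Sum>x\<in>C. (v i x - (\<Sum>j\<in>I. e j * v j x)) * v j x) = 0"
    using insert.IH by blast
  define f' where "f' x = f x - (\<Sum>j\<in>I. c j * v j x)" for x
  define a where "a x = v i x - (\<Sum>j\<in>I. e j * v j x)" for x
  \<comment> \<open>If \<open>a\<close> vanishes on \<open>C\<close>, the quotient is \<open>0\<close>, which is then the right coefficient.\<close>
  define t where "t = (\<Sum>x\<in>C. f' x * a x) / (\<Sum>x\<in>C. a x * a x)"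
  define c' where "c' j = (if j = i then t else c j - t * e j)" for j
  define r where "r x = f x - (\<Sum>j\<in>insert i I. c' j * v j x)" for x
  have r: "r x = f' x - t * a x" for x
  proof -
    have "(\<Sum>j\<in>I. c' j * v j x) = (\<Sum>j\<in>I. c j * v j x - t * (e j * v j x))"
      using insert.hyps by (intro sum.cong) (auto simp: c'_def algebra_simps)
    also have "\<dots> = (\<Sum>j\<in>I. c j * v j x) - t * (\<Sum>j\<in>I. e j * v j x)"
      by (simp add: sum_subtractf sum_distrib_left)
    finally show ?thesis
      using insert.hyps by (simp add: r_def f'_def a_def c'_def algebra_simps)
  qed
  have ra: "(\<Sum>x\<in>C. r x * a x) = 0"
  proof (cases "(\<Sum>x\<in>C. a x * a x) = 0")
    case True
    then have "\<forall>x\<in>C. a x * a x = 0"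
      using assms(2) by (subst (asm) sum_nonneg_eq_0_iff) auto
    then show ?thesis by (intro sum.neutral) auto
  next
    case False
    have "(\<Sum>x\<in>C. r x * a x) = (\<Sum>x\<in>C. f' x * a x) - t * (\<Sum>x\<in>C. a x * a x)"
      by (simp add: r left_diff_distrib sum_subtractf sum_distrib_left mult.assoc)
    also have "\<dots> = 0" using False by (simp add: t_def)
    finally show ?thesis .
  qed
  have rI: "(\<Sum>x\<in>C. r x * v j x) = 0" if "j \<in> I" for j
  proof -
    have "(\<Sum>x\<in>C. r x * v j x) = (\<Sum>x\<in>C. f' x * v j x) - t * (\<Sum>x\<in>C. a x * v j x)"
      by (simp add: r left_diff_distrib sum_subtractf sum_distrib_left mult.assoc)
    then show ?thesis using c[OF that] e[OF that] by (simp add: f'_def a_def)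
  qed
  have "(\<Sum>x\<in>C. r x * v i x) = (\<Sum>x\<in>C. r x * a x + (\<Sum>j\<in>I. e j * (r x * v j x)))"
    by (intro sum.cong) (simp_all add: a_def right_diff_distrib sum_distrib_left mult.left_commute)
  also have "\<dots> = (\<Sum>x\<in>C. \<Sum>j\<in>I. e j * (r x * v j x))"
    by (simp add: sum.distrib ra)
  also have "\<dots> = (\<Sum>j\<in>I. e j * (\<Sum>x\<in>C. r x * v j x))"
    by (subst sum.swap) (simp add: sum_distrib_left)
  also have "\<dots> = 0" by (simp add: rI)
  finally have "\<forall>j\<in>insert i I. (\<Sum>x\<in>C. r x * v j x) = 0" using rI by auto
  then show ?case unfolding r_def by blast
qed simp

text \<open>
  Hodge theory uses only that the differential has a matrix \<open>M\<close> indexed by a finite graded set, that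
  it has degree one, and that it squares to zero. The functions are compared by the inner product in
  which the indicator functions of \<open>C\<close> are orthonormal.
\<close>

locale finite_cochain_complex =
  fixes C :: "'c set" and deg :: "'c \<Rightarrow> nat" and M :: "'c \<Rightarrow> 'c \<Rightarrow> real"
  assumes finite_cells: "finite C"
    and degree: "x \<in> C \<Longrightarrow> y \<in> C \<Longrightarrow> M x y \<noteq> 0 \<Longrightarrow> deg x = Suc (deg y)"
    and square_zero: "x \<in> C \<Longrightarrow> z \<in> C \<Longrightarrow> (\<Sum>y\<in>C. M x y * M y z) = 0"
begin

definition inner :: "('c \<Rightarrow> real) \<Rightarrow> ('c \<Rightarrow> real) \<Rightarrow> real" where
  "inner f g = (\<Sum>x\<in>C. f x * g x)"

definition d :: "('c \<Rightarrow> real) \<Rightarrow> 'c \<Rightarrow> real" where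
  "d f = (\<lambda>x\<in>C. \<Sum>y\<in>C. M x y * f y)"

definition d_adj :: "('c \<Rightarrow> real) \<Rightarrow> 'c \<Rightarrow> real" where
  "d_adj f = (\<lambda>x\<in>C. \<Sum>y\<in>C. M y x * f y)"

definition dirac :: "('c \<Rightarrow> real) \<Rightarrow> 'c \<Rightarrow> real" where
  "dirac f = (\<lambda>x\<in>C. d f x + d_adj f x)"

definition graded :: "nat \<Rightarrow> ('c \<Rightarrow> real) set" where
  "graded k = {f \<in> C \<rightarrow>\<^sub>E UNIV. \<forall>x\<in>C. f x \<noteq> 0 \<longrightarrow> deg x = k}"

definition cocycle :: "nat \<Rightarrow> ('c \<Rightarrow> real) set" where
  "cocycle k = {f \<in> graded k. d f = (\<lambda>x\<in>C. 0)}"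

text \<open>
  The condition \<open>Suc (deg x) = k\<close> admits only the zero function when \<open>k = 0\<close>, so that degree \<open>0\<close> needs no
  separate treatment in the Hodge decomposition.
\<close>

definition coboundary :: "nat \<Rightarrow> ('c \<Rightarrow> real) set" where
  "coboundary k = d ` {g \<in> C \<rightarrow>\<^sub>E UNIV. \<forall>x\<in>C. g x \<noteq> 0 \<longrightarrow> Suc (deg x) = k}"

definition harmonic :: "nat \<Rightarrow> ('c \<Rightarrow> real) set" where
  "harmonic k = {f \<in> cocycle k. d_adj f = (\<lambda>x\<in>C. 0)}"

lemma inner_commute: "inner f g = inner g f"
  by (simp add: inner_def mult.commute)

lemma inner_self_eq_0: "inner f f = 0 \<longleftrightarrow> (\<forall>x\<in>C. f x = 0)"
  unfolding inner_def using finite_cells by (subst sum_nonneg_eq_0_iff) auto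

lemma adjoint: "inner (d f) g = inner f (d_adj g)"
proof -
  have "inner (d f) g = (\<Sum>x\<in>C. \<Sum>y\<in>C. f y * (M x y * g x))"
    by (simp add: inner_def d_def sum_distrib_left mult_ac)
  also have "\<dots> = inner f (d_adj g)"
    by (subst sum.swap) (simp add: inner_def d_adj_def sum_distrib_left)
  finally show ?thesis .
qed

lemma d_d: "x \<in> C \<Longrightarrow> d (d f) x = 0"
proof -
  assume x: "x \<in> C"
  have "d (d f) x = (\<Sum>y\<in>C. \<Sum>z\<in>C. M x y * M y z * f z)"
    using x by (simp add: d_def sum_distrib_left mult.assoc)
  also have "\<dots> = (\<Sum>z\<in>C. (\<Sum>y\<in>C. M x y * M y z) * f z)"
    by (subst sum.swap) (simp add: sum_distrib_right)
  also have "\<dots> = 0" using square_zero[OF x] by simp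
  finally show ?thesis .
qed

lemma inner_dirac: "inner (dirac f) g = inner f (dirac g)"
proof -
  have split: "inner (dirac f) g = inner (d f) g + inner (d_adj f) g" for f g
    by (simp add: inner_def dirac_def distrib_right sum.distrib)
  show ?thesis
    using adjoint[of f g] adjoint[of g f] split[of f g] split[of g f]
    by (simp add: inner_commute[of f] inner_commute[of g])
qed

lemma d_support:
  assumes "x \<in> C" "d f x \<noteq> 0"
  obtains y where "y \<in> C" "f y \<noteq> 0" "deg x = Suc (deg y)"
proof -
  have "(\<Sum>y\<in>C. M x y * f y) \<noteq> 0" using assms by (simp add: d_def)
  then obtain y where "y \<in> C" "M x y * f y \<noteq> 0" by (rule sum.not_neutral_contains_not_neutral)
  with that[of y] degree[OF assms(1), of y] show thesis by simp
qed

text \<open>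
  Since \<open>f\<close> lives in degree \<open>k\<close>, the component of \<open>dirac (dirac f)\<close> in that degree suffices to conclude
  that its inner product with \<open>f\<close>, which is the squared norm of \<open>dirac f\<close>, is zero. Hence
  \<open>d f = - d_adj f\<close>, and as \<open>d f\<close> is orthogonal to \<open>d_adj f\<close> because \<open>d (d f) = 0\<close>, both vanish.
\<close>

lemma harmonic_iff_laplacian:
  assumes f: "f \<in> graded k"
  shows "f \<in> harmonic k \<longleftrightarrow> (\<forall>x\<in>C. deg x = k \<longrightarrow> dirac (dirac f) x = 0)"
proof
  assume "f \<in> harmonic k"
  then have "\<forall>x\<in>C. dirac f x = 0"
    by (simp add: harmonic_def cocycle_def dirac_def)
  then have "\<forall>x\<in>C. dirac (dirac f) x = 0"
    by (simp add: dirac_def d_def d_adj_def)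
  then show "\<forall>x\<in>C. deg x = k \<longrightarrow> dirac (dirac f) x = 0" by blast
next
  assume lap: "\<forall>x\<in>C. deg x = k \<longrightarrow> dirac (dirac f) x = 0"
  have "f x * dirac (dirac f) x = 0" if "x \<in> C" for x
    using lap f that by (cases "f x = 0") (auto simp: graded_def)
  then have "inner f (dirac (dirac f)) = 0" unfolding inner_def by (intro sum.neutral) blast
  then have "inner (dirac f) (dirac f) = 0" by (simp add: inner_dirac)
  then have sum0: "d f x + d_adj f x = 0" if "x \<in> C" for x
    using that by (simp add: inner_self_eq_0 dirac_def)
  have "inner (d f) (d f) = - inner (d f) (d_adj f)"
    unfolding inner_def sum_negf[symmetric]
    by (intro sum.cong) (use sum0 in \<open>auto simp: eq_neg_iff_add_eq_0 distrib_left[symmetric]\<close>)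
  also have "inner (d f) (d_adj f) = inner f (d (d f))"
    using adjoint[of "d f" f] by (simp add: inner_commute)
  also have "\<dots> = 0" by (simp add: inner_def d_d)
  finally have "inner (d f) (d f) = 0" by simp
  then have d0: "\<forall>x\<in>C. d f x = 0" by (simp add: inner_self_eq_0)
  moreover have "\<forall>x\<in>C. d_adj f x = 0" using d0 sum0 by force
  ultimately have "d f = (\<lambda>x\<in>C. 0)" "d_adj f = (\<lambda>x\<in>C. 0)"
    by (auto simp: d_def d_adj_def fun_eq_iff)
  with f show "f \<in> harmonic k" by (simp add: harmonic_def cocycle_def)
qed

lemma coboundary_subset_cocycle: "coboundary k \<subseteq> cocycle k"
proof
  fix b assume "b \<in> coboundary k"
  then obtain g where g: "\<forall>x\<in>C. g x \<noteq> 0 \<longrightarrow> Suc (deg x) = k" "b = d g" by (auto simp: coboundary_def)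
  have "deg x = k" if "x \<in> C" "d g x \<noteq> 0" for x
    using d_support[OF that] g(1) by metis
  moreover have "d (d g) = (\<lambda>x\<in>C. 0)" using d_d[of _ g] by (auto simp: d_def fun_eq_iff)
  moreover have "d g \<in> C \<rightarrow>\<^sub>E UNIV" by (auto simp: d_def)
  ultimately show "b \<in> cocycle k" using g(2) by (auto simp: cocycle_def graded_def)
qed

text \<open>
  A harmonic function \<open>d g\<close> satisfies \<open>\<langle>d g, d g\<rangle> = \<langle>g, d_adj (d g)\<rangle> = 0\<close>.
\<close>

lemma coboundary_Int_harmonic: "b \<in> coboundary k \<Longrightarrow> b \<in> harmonic k \<Longrightarrow> b = (\<lambda>x\<in>C. 0)"
proof -
  assume "b \<in> coboundary k" "b \<in> harmonic k"
  then obtain g where g: "b = d g" "d_adj b = (\<lambda>x\<in>C. 0)"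
    by (auto simp: coboundary_def harmonic_def)
  have "inner b b = inner g (d_adj b)" unfolding g(1) by (rule adjoint)
  also have "\<dots> = 0" by (simp add: g(2) inner_def)
  finally have "\<forall>x\<in>C. b x = 0" by (simp add: inner_self_eq_0)
  then show ?thesis by (auto simp: g(1) d_def fun_eq_iff)
qed

text \<open>
  The coboundary \<open>b\<close> is the orthogonal projection of \<open>f\<close> to the span of the columns of \<open>M\<close> at cells of
  degree one below \<open>k\<close>. Orthogonality of the remainder to these columns says that its image under
  \<open>d_adj\<close> vanishes at those cells; elsewhere it vanishes for reasons of degree.
\<close>

lemma hodge_decomposition:
  assumes f: "f \<in> cocycle k"
  obtains b h where "b \<in> coboundary k" "h \<in> harmonic k" "f = (\<lambda>x\<in>C. b x + h x)"
proof -
  let ?I = "{y \<in> C. Suc (deg y) = k}"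
  have "finite ?I" using finite_cells by simp
  then obtain c where c: "\<And>y. y \<in> ?I \<Longrightarrow> (\<Sum>x\<in>C. (f x - (\<Sum>z\<in>?I. c z * M x z)) * M x y) = 0"
    using orthogonal_projection[OF _ finite_cells, of ?I f "\<lambda>y x. M x y"] by blast
  define g where "g = (\<lambda>y\<in>C. if y \<in> ?I then c y else 0)"
  define h where "h = (\<lambda>x\<in>C. f x - d g x)"
  have b: "d g \<in> coboundary k"
    unfolding coboundary_def by (rule imageI) (auto simp: g_def split: if_splits)
  then have bz: "d g \<in> cocycle k" using coboundary_subset_cocycle by blast
  have dg: "d g x = (\<Sum>z\<in>?I. c z * M x z)" if "x \<in> C" for x
  proof -
    have "d g x = (\<Sum>y\<in>C. if y \<in> ?I then c y * M x y else 0)"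
      using that unfolding d_def g_def by (auto intro!: sum.cong)
    also have "\<dots> = (\<Sum>y\<in>C \<inter> ?I. c y * M x y)"
      using finite_cells by (simp add: sum.inter_restrict)
    also have "C \<inter> ?I = ?I" by auto
    finally show ?thesis .
  qed
  have supp: "deg x = k" if "x \<in> C" "h x \<noteq> 0" for x
    using that f bz by (cases "f x = 0") (auto simp: h_def cocycle_def graded_def)
  have "d h x = d f x - d (d g) x" if "x \<in> C" for x
    using that by (simp add: d_def h_def right_diff_distrib sum_subtractf)
  then have dh: "d h = (\<lambda>x\<in>C. 0)"
    using f bz by (auto simp: cocycle_def fun_eq_iff d_def[of h])
  have "d_adj h y = 0" if y: "y \<in> C" for y
  proof (cases "y \<in> ?I")
    case True
    have "d_adj h y = (\<Sum>x\<in>C. (f x - (\<Sum>z\<in>?I. c z * M x z)) * M x y)"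
      using y dg by (simp add: d_adj_def h_def mult.commute)
    then show ?thesis using c[OF True] by simp
  next
    case False
    have "M x y * h x = 0" if "x \<in> C" for x
      using supp[OF that] degree[OF that y] False y by (cases "h x = 0") auto
    then show ?thesis using y by (simp add: d_adj_def)
  qed
  then have "d_adj h = (\<lambda>x\<in>C. 0)" by (auto simp: fun_eq_iff d_adj_def[of h])
  then have "h \<in> harmonic k"
    using dh supp by (auto simp: harmonic_def cocycle_def graded_def h_def)
  moreover have "f = (\<lambda>x\<in>C. d g x + h x)"
    using f by (auto simp: h_def fun_eq_iff cocycle_def graded_def PiE_def extensional_def)
  ultimately show thesis using that b by blast
qed

end

section \<open>Dimension of a quotient by a complemented subspace\<close>

lemma linear_mapI:
  assumes "vectorspace K V" "vectorspace K W"
    and "\<And>v. v \<in> carrier V \<Longrightarrow> T v \<in> carrier W"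
    and "\<And>v w. v \<in> carrier V \<Longrightarrow> w \<in> carrier V \<Longrightarrow> T (v \<oplus>\<^bsub>V\<^esub> w) = T v \<oplus>\<^bsub>W\<^esub> T w"
    and "\<And>c v. c \<in> carrier K \<Longrightarrow> v \<in> carrier V \<Longrightarrow> T (c \<odot>\<^bsub>V\<^esub> v) = c \<odot>\<^bsub>W\<^esub> T v"
  shows "linear_map K V W T"
proof -
  interpret V: vectorspace K V by fact
  interpret W: vectorspace K W by fact
  show ?thesis
    by unfold_locales (use assms(3-5) in \<open>auto simp: LinearCombinations.module_hom_def\<close>)
qed

text \<open>
  The vector space axioms are inherited by the image of a surjection compatible with the operations.
  Applied to the projection onto the set of cosets, this makes the quotient a vector space.
\<close>

lemma vectorspace_image:
  assumes V: "vectorspace K V" and surj: "T ` carrier V = carrier W"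
    and zero: "T \<zero>\<^bsub>V\<^esub> = \<zero>\<^bsub>W\<^esub>"
    and add: "\<And>v w. v \<in> carrier V \<Longrightarrow> w \<in> carrier V \<Longrightarrow> T (v \<oplus>\<^bsub>V\<^esub> w) = T v \<oplus>\<^bsub>W\<^esub> T w"
    and smult: "\<And>c v. c \<in> carrier K \<Longrightarrow> v \<in> carrier V \<Longrightarrow> T (c \<odot>\<^bsub>V\<^esub> v) = c \<odot>\<^bsub>W\<^esub> T v"
  shows "vectorspace K W"
proof -
  interpret V: vectorspace K V by (rule V)
  have pre: "\<exists>v\<in>carrier V. w = T v" if "w \<in> carrier W" for w using that surj by blast
  have mem: "T v \<in> carrier W" if "v \<in> carrier V" for v using that surj by blast
  show ?thesis
  proof (rule vs_criteria)
    show "field K" by unfold_locales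
    show "\<zero>\<^bsub>W\<^esub> \<in> carrier W" using mem[of "\<zero>\<^bsub>V\<^esub>"] zero by simp
    show "\<forall>v w. v \<in> carrier W \<and> w \<in> carrier W \<longrightarrow> v \<oplus>\<^bsub>W\<^esub> w \<in> carrier W"
      using pre mem add by (metis V.a_closed)
    show "\<forall>v\<in>carrier W. \<exists>n\<in>carrier W. v \<oplus>\<^bsub>W\<^esub> n = \<zero>\<^bsub>W\<^esub>"
    proof
      fix w assume "w \<in> carrier W"
      then obtain v where v: "v \<in> carrier V" "w = T v" using pre by blast
      then have "w \<oplus>\<^bsub>W\<^esub> T (\<ominus>\<^bsub>V\<^esub> v) = \<zero>\<^bsub>W\<^esub>"
        using add[of v "\<ominus>\<^bsub>V\<^esub> v"] by (simp add: V.r_neg zero)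
      then show "\<exists>n\<in>carrier W. w \<oplus>\<^bsub>W\<^esub> n = \<zero>\<^bsub>W\<^esub>" using mem v by blast
    qed
    show "\<forall>c v. c \<in> carrier K \<and> v \<in> carrier W \<longrightarrow> c \<odot>\<^bsub>W\<^esub> v \<in> carrier W"
      using pre mem smult by (metis V.smult_closed)
    show "\<forall>v w. v \<in> carrier W \<and> w \<in> carrier W \<longrightarrow> v \<oplus>\<^bsub>W\<^esub> w = w \<oplus>\<^bsub>W\<^esub> v"
      using pre add by (metis V.a_comm)
    show "\<forall>v w x. v \<in> carrier W \<and> w \<in> carrier W \<and> x \<in> carrier W
        \<longrightarrow> v \<oplus>\<^bsub>W\<^esub> w \<oplus>\<^bsub>W\<^esub> x = v \<oplus>\<^bsub>W\<^esub> (w \<oplus>\<^bsub>W\<^esub> x)"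
    proof (intro allI impI, elim conjE)
      fix v w x assume "v \<in> carrier W" "w \<in> carrier W" "x \<in> carrier W"
      then obtain v' w' x' where "v' \<in> carrier V" "w' \<in> carrier V" "x' \<in> carrier V"
        "v = T v'" "w = T w'" "x = T x'" using pre by metis
      then show "v \<oplus>\<^bsub>W\<^esub> w \<oplus>\<^bsub>W\<^esub> x = v \<oplus>\<^bsub>W\<^esub> (w \<oplus>\<^bsub>W\<^esub> x)"
        by (simp add: add[symmetric] V.a_assoc)
    qed
    show "\<forall>v\<in>carrier W. v \<oplus>\<^bsub>W\<^esub> \<zero>\<^bsub>W\<^esub> = v"
      using pre add zero by (metis V.r_zero V.zero_closed)
    have smult': "c \<odot>\<^bsub>W\<^esub> T v = T (c \<odot>\<^bsub>V\<^esub> v)" if "c \<in> carrier K" "v \<in> carrier V" for c v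
      using smult[OF that] ..
    have add': "T v \<oplus>\<^bsub>W\<^esub> T w = T (v \<oplus>\<^bsub>V\<^esub> w)" if "v \<in> carrier V" "w \<in> carrier V" for v w
      using add[OF that] ..
    show "\<forall>a b v. a \<in> carrier K \<and> b \<in> carrier K \<and> v \<in> carrier W
        \<longrightarrow> (a \<otimes>\<^bsub>K\<^esub> b) \<odot>\<^bsub>W\<^esub> v = a \<odot>\<^bsub>W\<^esub> (b \<odot>\<^bsub>W\<^esub> v)"
    proof (intro allI impI, elim conjE)
      fix a b w assume ab: "a \<in> carrier K" "b \<in> carrier K" and "w \<in> carrier W"
      then obtain v where "v \<in> carrier V" "w = T v" using pre by blast
      then show "(a \<otimes>\<^bsub>K\<^esub> b) \<odot>\<^bsub>W\<^esub> w = a \<odot>\<^bsub>W\<^esub> (b \<odot>\<^bsub>W\<^esub> w)"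
        using ab by (simp add: smult' V.smult_assoc1)
    qed
    show "\<forall>v\<in>carrier W. \<one>\<^bsub>K\<^esub> \<odot>\<^bsub>W\<^esub> v = v"
      using pre smult by (metis V.smult_one V.R.one_closed)
    show "\<forall>a b v. a \<in> carrier K \<and> b \<in> carrier K \<and> v \<in> carrier W
        \<longrightarrow> (a \<oplus>\<^bsub>K\<^esub> b) \<odot>\<^bsub>W\<^esub> v = a \<odot>\<^bsub>W\<^esub> v \<oplus>\<^bsub>W\<^esub> b \<odot>\<^bsub>W\<^esub> v"
    proof (intro allI impI, elim conjE)
      fix a b w assume ab: "a \<in> carrier K" "b \<in> carrier K" and "w \<in> carrier W"
      then obtain v where "v \<in> carrier V" "w = T v" using pre by blast
      then show "(a \<oplus>\<^bsub>K\<^esub> b) \<odot>\<^bsub>W\<^esub> w = a \<odot>\<^bsub>W\<^esub> w \<oplus>\<^bsub>W\<^esub> b \<odot>\<^bsub>W\<^esub> w"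
        using ab by (simp add: smult' add' V.smult_l_distr)
    qed
    show "\<forall>a v w. a \<in> carrier K \<and> v \<in> carrier W \<and> w \<in> carrier W
        \<longrightarrow> a \<odot>\<^bsub>W\<^esub> (v \<oplus>\<^bsub>W\<^esub> w) = a \<odot>\<^bsub>W\<^esub> v \<oplus>\<^bsub>W\<^esub> a \<odot>\<^bsub>W\<^esub> w"
    proof (intro allI impI, elim conjE)
      fix a v w assume a: "a \<in> carrier K" and "v \<in> carrier W" "w \<in> carrier W"
      then obtain v' w' where "v' \<in> carrier V" "w' \<in> carrier V" "v = T v'" "w = T w'"
        using pre by metis
      then show "a \<odot>\<^bsub>W\<^esub> (v \<oplus>\<^bsub>W\<^esub> w) = a \<odot>\<^bsub>W\<^esub> v \<oplus>\<^bsub>W\<^esub> a \<odot>\<^bsub>W\<^esub> w"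
        using a by (simp add: smult' add' V.smult_r_distr)
    qed
  qed
qed

lemma linear_map_inverse:
  assumes "linear_map K V W T" and inj: "inj_on T (carrier V)" and surj: "T ` carrier V = carrier W"
  shows "linear_map K W V (inv_into (carrier V) T)"
proof -
  interpret T: linear_map K V W T by fact
  let ?S = "inv_into (carrier V) T"
  have S: "?S w \<in> carrier V" "T (?S w) = w" if "w \<in> carrier W" for w
    using that surj by (auto simp: inv_into_into f_inv_into_f)
  have eq: "?S w = v" if "w \<in> carrier W" "v \<in> carrier V" "T v = w" for v w
    using that inj by auto
  show ?thesis
  proof (rule linear_mapI)
    fix v w assume "v \<in> carrier W" "w \<in> carrier W"
    then show "?S (v \<oplus>\<^bsub>W\<^esub> w) = ?S v \<oplus>\<^bsub>V\<^esub> ?S w" using S by (intro eq) auto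
  next
    fix c w assume "c \<in> carrier K" "w \<in> carrier W"
    then show "?S (c \<odot>\<^bsub>W\<^esub> w) = c \<odot>\<^bsub>V\<^esub> ?S w" using S by (intro eq) auto
  qed (use S in \<open>auto intro: T.V.vectorspace_axioms T.W.vectorspace_axioms\<close>)
qed

text \<open>
  The dimension is the least size of a finite generating set. When there is no such set it is an
  unspecified number, but then neither space has one: finite dimensionality passes along the bijection
  and along its inverse.
\<close>

lemma dim_eq_of_bijective:
  assumes T: "linear_map K V W T"
    and inj: "inj_on T (carrier V)" and surj: "T ` carrier V = carrier W"
  shows "vectorspace.dim K V = vectorspace.dim K W"
proof -
  interpret T: linear_map K V W T by (rule T)
  let ?S = "inv_into (carrier V) T"
  interpret S: linear_map K W V ?S by (rule linear_map_inverse[OF assms])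
  have "?S ` carrier W = carrier V" using inj surj by (metis inv_into_image_cancel order_refl)
  then have fin: "T.V.fin_dim \<longleftrightarrow> T.W.fin_dim"
    using T.surj_fin_dim[OF _ surj] S.surj_fin_dim by blast
  show ?thesis
  proof (cases T.V.fin_dim)
    case True
    then show ?thesis using T.dim_eq inj surj by blast
  next
    case False
    have "T.V.dim = (LEAST n. False)"
      unfolding T.V.dim_def
      by (rule arg_cong[where f = Least]) (use False T.V.fin_dim_def in blast)
    moreover have "T.W.dim = (LEAST n. False)"
      unfolding T.W.dim_def
      by (rule arg_cong[where f = Least]) (use False fin T.W.fin_dim_def in blast)
    ultimately show ?thesis by simp
  qed
qed

lemma subspace_in_subspace:
  assumes "VectorSpace.subspace K Z V" "VectorSpace.subspace K W V" "W \<subseteq> Z"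
  shows "VectorSpace.subspace K W (V\<lparr>carrier := Z\<rparr>)"
proof -
  interpret V: vectorspace K V using assms(1) by (rule subspace.vs)
  have "vectorspace K (V\<lparr>carrier := Z\<rparr>)" by (rule V.subspace_is_vs[OF assms(1)])
  then show ?thesis
    using assms by (auto simp: VectorSpace.subspace_def LinearCombinations.submodule_def vectorspace_def)
qed

text \<open>
  A complement of \<open>W\<close> meets every coset of \<open>W\<close> in exactly one point, so the projection restricts to an
  isomorphism from the complement \<open>U\<close> to the quotient.
\<close>

lemma dim_quotient_space:
  assumes W: "VectorSpace.subspace K W V" and U: "VectorSpace.subspace K U V"
    and Int: "W \<inter> U \<subseteq> {\<zero>\<^bsub>V\<^esub>}"
    and sum: "\<And>v. v \<in> carrier V \<Longrightarrow> \<exists>w\<in>W. \<exists>u\<in>U. v = w \<oplus>\<^bsub>V\<^esub> u"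
  shows "vectorspace.dim K (quotient_space V W) = vectorspace.dim K (V\<lparr>carrier := U\<rparr>)"
proof -
  interpret V: vectorspace K V using W by (rule subspace.vs)
  let ?Q = "quotient_space V W" and ?T = "\<lambda>v. W +>\<^bsub>V\<^esub> v"
  have Wsub: "LinearCombinations.submodule K W V" and Usub: "LinearCombinations.submodule K U V"
    using W U by (auto simp: VectorSpace.subspace_def)
  note Wc = submodule.subset[OF Wsub] and Uc = submodule.subset[OF Usub]
  have "\<ominus>\<^bsub>V\<^esub> w \<in> W" if "w \<in> W" for w
    using submodule.smult_closed[OF Wsub, of "\<ominus>\<^bsub>K\<^esub> \<one>\<^bsub>K\<^esub>" w] that Wc
    by (auto simp: V.smult_minus_1)
  then have subgroup: "subgroup W (add_monoid V)"
    using Wc submodule.m_closed[OF Wsub] submodule.zero_closed[OF Wsub]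
    by unfold_locales (auto simp: a_inv_def)
  then interpret W: abelian_subgroup W V
    by (intro abelian_subgroupI3 additive_subgroup.intro V.abelian_group_axioms)
  have smult: "?T (c \<odot>\<^bsub>V\<^esub> v) = c \<odot>\<^bsub>?Q\<^esub> ?T v" if c: "c \<in> carrier K" and v: "v \<in> carrier V" for c v
  proof -
    have "?T (c \<odot>\<^bsub>V\<^esub> x) = ?T (c \<odot>\<^bsub>V\<^esub> v)" if x: "x \<in> ?T v" for x
    proof -
      obtain w where w: "w \<in> W" "x = w \<oplus>\<^bsub>V\<^esub> v" using x by (auto simp: a_r_coset_def')
      then have "c \<odot>\<^bsub>V\<^esub> x = c \<odot>\<^bsub>V\<^esub> w \<oplus>\<^bsub>V\<^esub> c \<odot>\<^bsub>V\<^esub> v"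
        using c v Wc by (auto simp: V.smult_r_distr)
      moreover have "c \<odot>\<^bsub>V\<^esub> w \<in> W" using submodule.smult_closed[OF Wsub] c w by blast
      ultimately have "c \<odot>\<^bsub>V\<^esub> x \<in> ?T (c \<odot>\<^bsub>V\<^esub> v)" by (auto simp: a_r_coset_def')
      then show ?thesis
        using c v by (intro V.a_repr_independence[symmetric] V.smult_closed subgroup)
    qed
    moreover have "v \<in> ?T v" using v by (rule W.a_rcos_self)
    ultimately have "(\<Union>x\<in>?T v. ?T (c \<odot>\<^bsub>V\<^esub> x)) = ?T (c \<odot>\<^bsub>V\<^esub> v)"
      by (intro UN_constant_eq) blast+
    then show ?thesis by (simp add: quotient_space_def)
  qed
  have add: "?T (v \<oplus>\<^bsub>V\<^esub> w) = ?T v \<oplus>\<^bsub>?Q\<^esub> ?T w" if "v \<in> carrier V" "w \<in> carrier V" for v w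
    using that by (simp add: quotient_space_def W.a_rcos_sum)
  have surj: "?T ` carrier V = carrier ?Q"
    by (auto simp: quotient_space_def A_RCOSETS_def')
  have zero: "?T v = \<zero>\<^bsub>?Q\<^esub> \<longleftrightarrow> v \<in> W" if v: "v \<in> carrier V" for v
  proof
    assume "?T v = \<zero>\<^bsub>?Q\<^esub>"
    then show "v \<in> W" using W.a_rcos_self[OF v] by (simp add: quotient_space_def)
  next
    assume "v \<in> W"
    then show "?T v = \<zero>\<^bsub>?Q\<^esub>"
      using V.a_coset_join2[OF v subgroup] by (simp add: quotient_space_def)
  qed
  have Q: "vectorspace K ?Q"
    using zero[of "\<zero>\<^bsub>V\<^esub>"] submodule.zero_closed[OF Wsub]
    by (intro vectorspace_image[OF V.vectorspace_axioms surj] add smult) auto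
  then interpret Q: vectorspace K ?Q .
  interpret U: vectorspace K "V\<lparr>carrier := U\<rparr>" by (rule V.subspace_is_vs[OF U])
  interpret T: linear_map K "V\<lparr>carrier := U\<rparr>" ?Q ?T
    by (rule linear_mapI) (use U.vectorspace_axioms Q in \<open>auto simp: surj[symmetric] add smult subsetD[OF Uc]\<close>)
  have "mod_hom.ker (V\<lparr>carrier := U\<rparr>) ?Q ?T = {u \<in> U. ?T u = \<zero>\<^bsub>?Q\<^esub>}"
    by (simp add: T.ker_def)
  also have "\<dots> = W \<inter> U" using zero Uc by blast
  also have "\<dots> = {\<zero>\<^bsub>V\<^esub>}"
    using Int submodule.zero_closed[OF Usub] submodule.zero_closed[OF Wsub] by blast
  finally have "mod_hom.ker (V\<lparr>carrier := U\<rparr>) ?Q ?T = {\<zero>\<^bsub>V\<^esub>}" .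
  then have "inj_on ?T (carrier (V\<lparr>carrier := U\<rparr>))" by (intro T.Ke0_imp_inj) simp
  moreover have "?T ` carrier (V\<lparr>carrier := U\<rparr>) = carrier ?Q"
  proof
    show "?T ` carrier (V\<lparr>carrier := U\<rparr>) \<subseteq> carrier ?Q" using Uc by (auto simp: surj[symmetric])
    show "carrier ?Q \<subseteq> ?T ` carrier (V\<lparr>carrier := U\<rparr>)"
    proof
      fix q assume "q \<in> carrier ?Q"
      then obtain v where v: "v \<in> carrier V" "q = ?T v" using surj by blast
      obtain w u where wu: "w \<in> W" "u \<in> U" "v = w \<oplus>\<^bsub>V\<^esub> u" using sum[OF v(1)] by blast
      have "v \<in> ?T u" using wu by (auto simp: a_r_coset_def')
      then have "?T u = q" unfolding v(2) using wu Uc by (intro V.a_repr_independence subgroup) auto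
      then show "q \<in> ?T ` carrier (V\<lparr>carrier := U\<rparr>)" using wu(2) by auto
    qed
  qed
  ultimately show ?thesis using dim_eq_of_bijective[OF T.linear_map_axioms] by simp
qed

section \<open>Cohomology and harmonic functions as vector spaces\<close>

context finite_cochain_complex
begin

abbreviation cochain_space :: "(real, 'c \<Rightarrow> real) module" where
  "cochain_space \<equiv> ring.func_space real_field C"

abbreviation graded_space :: "nat \<Rightarrow> (real, 'c \<Rightarrow> real) module" where
  "graded_space k \<equiv> cochain_space\<lparr>carrier := graded k\<rparr>"

lemma cochain_space_ops:
  "carrier cochain_space = C \<rightarrow>\<^sub>E UNIV"
  "\<zero>\<^bsub>cochain_space\<^esub> = (\<lambda>x\<in>C. 0)"
  "f \<oplus>\<^bsub>cochain_space\<^esub> g = (\<lambda>x\<in>C. f x + g x)"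
  "c \<odot>\<^bsub>cochain_space\<^esub> f = (\<lambda>x\<in>C. c * f x)"
  by (simp_all add: class_ring.func_space_def)

lemma func_space_subspaceI:
  assumes "W \<subseteq> C \<rightarrow>\<^sub>E UNIV" "(\<lambda>x\<in>C. 0) \<in> W"
    and "\<And>f g. f \<in> W \<Longrightarrow> g \<in> W \<Longrightarrow> (\<lambda>x\<in>C. f x + g x) \<in> W"
    and "\<And>c f. f \<in> W \<Longrightarrow> (\<lambda>x\<in>C. c * f x) \<in> W"
  shows "VectorSpace.subspace real_field W cochain_space"
proof -
  have "module real_field cochain_space" by (rule class_cring.func_space_is_module)
  moreover from this have "vectorspace real_field cochain_space"
    by (intro vectorspace.intro class_field)
  ultimately show ?thesis
    using assms
    by (auto simp: VectorSpace.subspace_def LinearCombinations.submodule_def cochain_space_ops)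
qed

lemma d_add: "d (\<lambda>x\<in>C. f x + g x) = (\<lambda>x\<in>C. d f x + d g x)"
  by (auto simp: d_def fun_eq_iff distrib_left sum.distrib)

lemma d_scale: "d (\<lambda>x\<in>C. c * f x) = (\<lambda>x\<in>C. c * d f x)"
  by (auto simp: d_def fun_eq_iff sum_distrib_left mult.left_commute)

lemma d_adj_add: "d_adj (\<lambda>x\<in>C. f x + g x) = (\<lambda>x\<in>C. d_adj f x + d_adj g x)"
  by (auto simp: d_adj_def fun_eq_iff distrib_left sum.distrib)

lemma d_adj_scale: "d_adj (\<lambda>x\<in>C. c * f x) = (\<lambda>x\<in>C. c * d_adj f x)"
  by (auto simp: d_adj_def fun_eq_iff sum_distrib_left mult.left_commute)

lemma dirac_add: "dirac (\<lambda>x\<in>C. f x + g x) = (\<lambda>x\<in>C. dirac f x + dirac g x)"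
  by (auto simp: dirac_def d_add d_adj_add fun_eq_iff)

lemma dirac_scale: "dirac (\<lambda>x\<in>C. c * f x) = (\<lambda>x\<in>C. c * dirac f x)"
  by (auto simp: dirac_def d_scale d_adj_scale fun_eq_iff distrib_left)

lemma graded_subspace: "VectorSpace.subspace real_field (graded k) cochain_space"
proof (rule func_space_subspaceI)
  fix f g assume "f \<in> graded k" "g \<in> graded k"
  then show "(\<lambda>x\<in>C. f x + g x) \<in> graded k"
    unfolding graded_def by (force simp: restrict_PiE_iff)
qed (auto simp: graded_def)

lemma cocycle_subspace: "VectorSpace.subspace real_field (cocycle k) cochain_space"
proof -
  note sub = subspace.submod[OF graded_subspace, of k]
  show ?thesis
  proof (rule func_space_subspaceI)
    show "cocycle k \<subseteq> C \<rightarrow>\<^sub>E UNIV" by (auto simp: cocycle_def graded_def)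
    show "(\<lambda>x\<in>C. 0) \<in> cocycle k" by (auto simp: cocycle_def graded_def d_def)
  next
    fix f g assume "f \<in> cocycle k" "g \<in> cocycle k"
    then show "(\<lambda>x\<in>C. f x + g x) \<in> cocycle k"
      using submodule.m_closed[OF sub, of f g]
      by (auto simp: cocycle_def d_add cochain_space_ops)
  next
    fix c f assume "f \<in> cocycle k"
    then show "(\<lambda>x\<in>C. c * f x) \<in> cocycle k"
      using submodule.smult_closed[OF sub, of c f]
      by (auto simp: cocycle_def d_scale cochain_space_ops)
  qed
qed

lemma harmonic_subspace: "VectorSpace.subspace real_field (harmonic k) cochain_space"
proof -
  note sub = subspace.submod[OF cocycle_subspace, of k]
  show ?thesis
  proof (rule func_space_subspaceI)
    show "harmonic k \<subseteq> C \<rightarrow>\<^sub>E UNIV" by (auto simp: harmonic_def cocycle_def graded_def)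
    show "(\<lambda>x\<in>C. 0) \<in> harmonic k" by (auto simp: harmonic_def cocycle_def graded_def d_def d_adj_def)
  next
    fix f g assume "f \<in> harmonic k" "g \<in> harmonic k"
    then show "(\<lambda>x\<in>C. f x + g x) \<in> harmonic k"
      using submodule.m_closed[OF sub, of f g]
      by (auto simp: harmonic_def d_adj_add cochain_space_ops)
  next
    fix c f assume "f \<in> harmonic k"
    then show "(\<lambda>x\<in>C. c * f x) \<in> harmonic k"
      using submodule.smult_closed[OF sub, of c f]
      by (auto simp: harmonic_def d_adj_scale cochain_space_ops)
  qed
qed

lemma coboundary_Suc: "coboundary (Suc k) = d ` graded k"
  by (simp add: coboundary_def graded_def)

lemma coboundary_0: "coboundary 0 = {\<lambda>x\<in>C. 0}"
proof -
  have "{g \<in> C \<rightarrow>\<^sub>E UNIV. \<forall>x\<in>C. g x \<noteq> (0::real) \<longrightarrow> Suc (deg x) = 0} = {\<lambda>x\<in>C. 0}"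
    by (auto simp: PiE_def extensional_def fun_eq_iff)
  then show ?thesis by (auto simp: coboundary_def d_def fun_eq_iff)
qed

lemma coboundary_subspace: "VectorSpace.subspace real_field (coboundary k) cochain_space"
proof (cases k)
  case 0
  show ?thesis unfolding 0 coboundary_0 by (rule func_space_subspaceI) auto
next
  case (Suc j)
  note sub = subspace.submod[OF graded_subspace, of j]
  show ?thesis unfolding Suc coboundary_Suc
  proof (rule func_space_subspaceI)
    show "d ` graded j \<subseteq> C \<rightarrow>\<^sub>E UNIV" by (auto simp: d_def)
    have "(\<lambda>x\<in>C. 0) = d (\<lambda>x\<in>C. 0)" "(\<lambda>x\<in>C. 0) \<in> graded j"
      by (auto simp: d_def graded_def fun_eq_iff)
    then show "(\<lambda>x\<in>C. 0) \<in> d ` graded j" by blast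
  next
    fix b b' assume "b \<in> d ` graded j" "b' \<in> d ` graded j"
    then obtain f g where "f \<in> graded j" "g \<in> graded j" "b = d f" "b' = d g" by auto
    then show "(\<lambda>x\<in>C. b x + b' x) \<in> d ` graded j"
      using submodule.m_closed[OF sub, of f g] by (auto simp: d_add[symmetric] cochain_space_ops)
  next
    fix c b assume "b \<in> d ` graded j"
    then obtain f where "f \<in> graded j" "b = d f" by auto
    then show "(\<lambda>x\<in>C. c * b x) \<in> d ` graded j"
      using submodule.smult_closed[OF sub, of c f] by (auto simp: d_scale[symmetric] cochain_space_ops)
  qed
qed

text \<open>
  Every cohomology class has exactly one harmonic representative, because the harmonic functions are
  a complement of the coboundaries in the cocycles.
\<close>

lemma dim_cohomology_eq_dim_harmonic:
  "vectorspace.dim real_field (quotient_space (cochain_space\<lparr>carrier := cocycle k\<rparr>) (coboundary k))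
    = vectorspace.dim real_field (cochain_space\<lparr>carrier := harmonic k\<rparr>)"
proof -
  let ?Z = "cochain_space\<lparr>carrier := cocycle k\<rparr>"
  have "vectorspace.dim real_field (quotient_space ?Z (coboundary k))
      = vectorspace.dim real_field (?Z\<lparr>carrier := harmonic k\<rparr>)"
  proof (rule dim_quotient_space)
    show "VectorSpace.subspace real_field (coboundary k) ?Z"
      by (intro subspace_in_subspace cocycle_subspace coboundary_subspace coboundary_subset_cocycle)
    show "VectorSpace.subspace real_field (harmonic k) ?Z"
      by (intro subspace_in_subspace cocycle_subspace harmonic_subspace) (auto simp: harmonic_def)
    show "coboundary k \<inter> harmonic k \<subseteq> {\<zero>\<^bsub>?Z\<^esub>}"
      using coboundary_Int_harmonic by (auto simp: cochain_space_ops)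
    show "\<exists>b\<in>coboundary k. \<exists>h\<in>harmonic k. f = b \<oplus>\<^bsub>?Z\<^esub> h" if f: "f \<in> carrier ?Z" for f
    proof -
      have "f \<in> cocycle k" using f by simp
      then obtain b h where "b \<in> coboundary k" "h \<in> harmonic k" "f = (\<lambda>x\<in>C. b x + h x)"
        by (rule hodge_decomposition)
      then show ?thesis by (auto simp: cochain_space_ops)
    qed
  qed
  then show ?thesis by simp
qed

lemma graded_vectorspace: "vectorspace real_field (graded_space k)"
  using graded_subspace[of k] subspace.vs vectorspace.subspace_is_vs by blast

lemma d_linear_map: "linear_map real_field (graded_space k) (graded_space (Suc k)) d"
proof (rule linear_mapI)
  fix f assume "f \<in> carrier (graded_space k)"
  then have f: "\<And>x. x \<in> C \<Longrightarrow> f x \<noteq> 0 \<Longrightarrow> deg x = k" by (simp add: graded_def)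
  have "deg x = Suc k" if x: "x \<in> C" "d f x \<noteq> 0" for x
  proof -
    obtain y where "y \<in> C" "f y \<noteq> 0" "deg x = Suc (deg y)" using d_support[OF x] .
    with f show ?thesis by simp
  qed
  then show "d f \<in> carrier (graded_space (Suc k))"
    by (simp add: graded_def d_def)
qed (simp_all add: graded_vectorspace cochain_space_ops d_add d_scale)

lemma laplacian_block_linear_map:
  "linear_map real_field (graded_space k) (graded_space k)
     (\<lambda>f. \<lambda>x\<in>C. if deg x = k then dirac (dirac f) x else 0)"
proof (rule linear_mapI)
  let ?V = "graded_space k"
  let ?H = "\<lambda>f. \<lambda>x\<in>C. if deg x = k then dirac (dirac f) x else 0"
  show "vectorspace real_field ?V" "vectorspace real_field ?V" by (rule graded_vectorspace)+
  show "?H f \<in> carrier ?V" for f by (auto simp: graded_def)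
  have ops: "f \<oplus>\<^bsub>?V\<^esub> g = (\<lambda>x\<in>C. f x + g x)" "c \<odot>\<^bsub>?V\<^esub> f = (\<lambda>x\<in>C. c * f x)" for f g c
    by (simp_all add: cochain_space_ops)
  show "?H (f \<oplus>\<^bsub>?V\<^esub> g) = ?H f \<oplus>\<^bsub>?V\<^esub> ?H g" for f g
    unfolding ops dirac_add by (rule restrict_ext) simp
  show "?H (c \<odot>\<^bsub>?V\<^esub> f) = c \<odot>\<^bsub>?V\<^esub> ?H f" for c f
    unfolding ops dirac_scale by (rule restrict_ext) simp
qed

lemma kernel_d:
  "mod_hom.ker (graded_space k) (graded_space (Suc k)) d = cocycle k"
proof -
  interpret linear_map real_field "graded_space k" "graded_space (Suc k)" d
    by (rule d_linear_map)
  show ?thesis by (auto simp: ker_def cocycle_def cochain_space_ops)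
qed

lemma image_d: "mod_hom.im (graded_space k) d = coboundary (Suc k)"
proof -
  interpret linear_map real_field "graded_space k" "graded_space (Suc k)" d
    by (rule d_linear_map)
  show ?thesis by (simp add: im_def coboundary_Suc)
qed

lemma kernel_laplacian_block:
  "mod_hom.ker (graded_space k) (graded_space k)
     (\<lambda>f. \<lambda>x\<in>C. if deg x = k then dirac (dirac f) x else 0) = harmonic k"
proof -
  let ?H = "\<lambda>f. \<lambda>x\<in>C. if deg x = k then dirac (dirac f) x else 0"
  interpret linear_map real_field "graded_space k" "graded_space k" ?H
    by (rule laplacian_block_linear_map)
  have "?H f = (\<lambda>x\<in>C. 0) \<longleftrightarrow> (\<forall>x\<in>C. deg x = k \<longrightarrow> dirac (dirac f) x = 0)" for f
    by (auto simp: fun_eq_iff)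
  moreover have "harmonic k \<subseteq> graded k" by (auto simp: harmonic_def cocycle_def)
  ultimately show ?thesis
    using harmonic_iff_laplacian[of _ k] by (auto simp: ker_def cochain_space_ops)
qed

end

section \<open>Products of simplicial complexes\<close>

lemma product_cochain_complex:
  assumes "oriented_complexes Gs \<omega>s"
  shows "finite_cochain_complex (product_cells Gs) cell_dim (incidence Gs \<omega>s)"
proof
  have "finite G" if "G \<in> set Gs" for G
    using assms that by (auto simp: list_all2_conv_all_nth in_set_conv_nth abstract_simplicial_complex_def)
  then show fin: "finite (product_cells Gs)" by (rule finite_product_cells)
  show "cell_dim x = Suc (cell_dim y)"
    if "x \<in> product_cells Gs" "y \<in> product_cells Gs" "incidence Gs \<omega>s x y \<noteq> 0" for x y
  proof (rule ccontr)
    assume "cell_dim x \<noteq> Suc (cell_dim y)"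
    then have "incidence Gs \<omega>s x y = 0"
      unfolding incidence_def using that by (intro ext_deriv_degree[OF assms]) auto
    with that show False by simp
  qed
  show "(\<Sum>y\<in>product_cells Gs. incidence Gs \<omega>s x y * incidence Gs \<omega>s y z) = 0"
    if "x \<in> product_cells Gs" "z \<in> product_cells Gs" for x z
    using ext_deriv_ext_deriv[OF assms that(1), of "\<lambda>y. if y = z then 1 else 0"]
      ext_deriv_incidence[OF fin that(1), of \<omega>s "\<lambda>y. incidence Gs \<omega>s y z"]
    by (simp add: incidence_def[abs_def])
qed

theorem proposition1:
  fixes Gs :: "'a set set list"
    and \<omega>s :: "('a set \<Rightarrow> 'a list) list"
    and k :: nat
  assumes "Gs \<noteq> []"
    and "\<And>i. i < length Gs \<Longrightarrow> abstract_simplicial_complex (Gs ! i)"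
    and "length \<omega>s = length Gs"
    and "\<And>i. i < length Gs \<Longrightarrow> orientation (Gs ! i) (\<omega>s ! i)"
  shows "betti Gs \<omega>s k = vectorspace.dim real_field (hodge_kernel Gs \<omega>s k)"
proof -
  let ?C = "product_cells Gs"
  have "oriented_complexes Gs \<omega>s" using assms by (simp add: list_all2_conv_all_nth)
  then interpret cc: finite_cochain_complex ?C cell_dim "incidence Gs \<omega>s"
    by (rule product_cochain_complex)
  have cochains: "k_cochains Gs j = cc.graded_space j" for j
    by (simp add: k_cochains_def cochains_def cc.graded_def cc.cochain_space_ops)
  have d: "deriv_op Gs \<omega>s = cc.d"
    by (auto simp: deriv_op_def cc.d_def ext_deriv_incidence[OF cc.finite_cells] fun_eq_iff)
  have "(\<Sum>z\<in>?C. incidence Gs \<omega>s y z * (\<lambda>z\<in>?C. if z = x then 1 else 0) z) = incidence Gs \<omega>s y x"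
    if "x \<in> ?C" for x y
  proof -
    have "(\<Sum>z\<in>?C. incidence Gs \<omega>s y z * (\<lambda>z\<in>?C. if z = x then 1 else 0) z)
        = (\<Sum>z\<in>?C. if z = x then incidence Gs \<omega>s y z else 0)"
      by (intro sum.cong) auto
    then show ?thesis using that cc.finite_cells by simp
  qed
  then have d_adj: "transpose_op ?C cc.d = cc.d_adj"
    by (auto simp: transpose_op_def cc.d_def cc.d_adj_def fun_eq_iff intro!: sum.cong)
  have dirac: "dirac_op Gs \<omega>s = cc.dirac"
    by (auto simp: dirac_op_def d d_adj cc.dirac_def cochains_def cc.cochain_space_ops fun_eq_iff)
  have block: "hodge_block Gs \<omega>s k
      = (\<lambda>f. \<lambda>x\<in>?C. if cell_dim x = k then cc.dirac (cc.dirac f) x else 0)"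
    unfolding hodge_block_def[abs_def] hodge_laplacian_def dirac ..
  have Z: "cocycles Gs \<omega>s k = cc.cochain_space\<lparr>carrier := cc.cocycle k\<rparr>"
    by (simp add: cocycles_def cochains d cc.kernel_d)
  have B: "coboundaries Gs \<omega>s k = cc.coboundary k"
    by (cases k) (simp_all add: coboundaries_def cochains d cc.image_d cc.coboundary_0
        cochains_def cc.cochain_space_ops)
  have H: "hodge_kernel Gs \<omega>s k = cc.cochain_space\<lparr>carrier := cc.harmonic k\<rparr>"
    by (simp add: hodge_kernel_def cochains block cc.kernel_laplacian_block)
  show ?thesis
    unfolding betti_def cohomology_def Z B H by (rule cc.dim_cohomology_eq_dim_harmonic)
qed

end
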